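(* Fix $P\in\mathcal{P}_d$ and $u\in\mathcal{S}^{d-1}$. Let $\mu_P=\mathrm{E}[Z]$, where $Z$ is a random $d$-vector with distribution $P$, and let $r_u(P)=\sup\{r>0:\mu_P+ru\in C_P\}$ $(\in(0,+\infty])$. Then $r\mapsto ED(\mu_P+ru,P)$ is monotone strictly decreasing in $[0,r_u(P)]$ and $ED(\mu_P+ru,P)=0$ for $r\geq r_u(P)$.
   Context: A prime denotes transposition, $\mathbb{I}[A]$ is the indicator of $A$, and $\mathcal{S}^{d-1}=\{z\in\mathbb{R}^d:\|z\|=1\}$. $\mathcal{P}_d$ is the collection of probability measures over $\mathbb{R}^d$ that do not give probability one to any hyperplane of $\mathbb{R}^d$ (for $d=1$, to any singleton) and that have finite first-order moments. For $P\in\mathcal{P}_d$ and $z\in\mathbb{R}^d$, the expectile depth of $z$ with respect to $P$ is $$ED(z,P)=\inf_{u\in\mathcal{S}^{d-1}}\frac{\mathrm{E}[|u'(Z-z)|\,\mathbb{I}[u'(Z-z)\leq0]]}{\mathrm{E}[|u'(Z-z)|]},\qquad Z\sim P.$$ The $C$-support of $P$ is $C_P:=\{z\in\mathbb{R}^d:P[u'Z\leq u'z]>0\text{ for any }u\in\mathcal{S}^{d-1}\}$, where $Z\sim P$. If $r_u(P)=+\infty$, the interval $[0,r_u(P)]$ is to be read as $[0,+\infty)$. *)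

theory Defs
  imports "HOL-Probability.Probability"
begin

text \<open>
  A random vector \<open>Z \<sim> P\<close> is represented canonically, as the identity on the space of \<open>P\<close>.
  The dimension is \<open>CARD('d) \<ge> 1\<close>.
\<close>

definition prob_class :: "(real ^ 'd) measure set" where
  "prob_class = {P. prob_space P \<and> sets P = sets borel
      \<and> (\<forall>a b. a \<noteq> 0 \<longrightarrow> measure P {z. a \<bullet> z = b} \<noteq> 1)
      \<and> integrable P (\<lambda>z. z)}"

definition mean_vec :: "(real ^ 'd) measure \<Rightarrow> real ^ 'd" where
  "mean_vec P = (LINT z|P. z)"

text \<open>
  For \<open>P \<in> prob_class\<close> the denominators are positive and the quotients lie in \<open>[0, 1]\<close>, so
  that neither the convention \<open>x / 0 = 0\<close> nor the value of an unbounded infimum plays a role.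
\<close>

definition expectile_depth :: "real ^ 'd \<Rightarrow> (real ^ 'd) measure \<Rightarrow> real" where
  "expectile_depth z P =
     (INF u\<in>sphere 0 1.
        (LINT y|P. \<bar>u \<bullet> (y - z)\<bar> * indicator {y. u \<bullet> (y - z) \<le> 0} y)
        / (LINT y|P. \<bar>u \<bullet> (y - z)\<bar>))"

definition C_support :: "(real ^ 'd) measure \<Rightarrow> (real ^ 'd) set" where
  "C_support P = {z. \<forall>u\<in>sphere 0 1. measure P {y. u \<bullet> y \<le> u \<bullet> z} > 0}"

definition C_radius :: "real ^ 'd \<Rightarrow> (real ^ 'd) measure \<Rightarrow> ereal" where
  "C_radius u P = Sup (ereal ` {r. r > 0 \<and> mean_vec P + r *\<^sub>R u \<in> C_support P})"

end

theory Submission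
  imports Defs
begin

text \<open>
  Write \<open>N v z\<close> for the mean of the positive part of \<open>v \<bullet> (z - Z)\<close>, where \<open>Z \<sim> P\<close>. Since
  \<open>\<bar>x\<bar> = 2 * max 0 x - x\<close>, the quotient for direction \<open>v\<close> equals
  \<open>N v z / (2 * N v z - v \<bullet> (z - \<mu>))\<close>, where \<open>\<mu>\<close> is the mean of \<open>P\<close>. This formula compares the
  quotient with \<open>1/2\<close>: along the ray \<open>z = \<mu> + r u\<close> with \<open>r > 0\<close> it is below \<open>1/2\<close> exactly if
  \<open>v \<bullet> u < 0\<close>. For such \<open>v\<close> the numerator \<open>N\<close> decreases weakly in \<open>r\<close> and the term
  \<open>- r * (v \<bullet> u)\<close> increases strictly, so the quotient decreases strictly as long as \<open>N\<close> was
  positive (lemma \<open>lower_quotient_strict_decrease\<close>).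

  \<open>N\<close> is Lipschitz in \<open>v\<close>, hence the quotient is continuous on the unit sphere and the infimum is
  a minimum (lemma \<open>expectile_depth_attained\<close>). The direction \<open>-u\<close> shows that this minimum is
  below \<open>1/2\<close>, so it is attained at some \<open>v\<close> with \<open>v \<bullet> u < 0\<close>; keeping that \<open>v\<close> while \<open>r\<close> grows
  gives strict monotonicity.

  The radius enters because the depth vanishes exactly if \<open>N v z = 0\<close>, that is
  \<open>P {y. v \<bullet> y < v \<bullet> z} = 0\<close>, for some unit vector \<open>v\<close>. The \<open>C\<close>-support has the weak inequality in place of the
  strict one; a small step along the ray bridges the difference. Moving inwards from a point of
  the \<open>C\<close>-support makes the inequality strict for every \<open>v\<close> with \<open>v \<bullet> u < 0\<close>. Conversely, a
  point of positive depth has \<open>N\<close> bounded away from zero on the sphere, so by the Lipschitz bound in \<open>z\<close> it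
  can be moved slightly outwards without leaving the \<open>C\<close>-support
  (lemma \<open>C_support_beyond_positive_depth\<close>). The latter argument yields both the positivity of the
  radius and the vanishing of the depth at the radius itself.
\<close>

section \<open>Lower partial moments in a direction\<close>

definition lower_moment :: "(real ^ 'd) measure \<Rightarrow> real ^ 'd \<Rightarrow> real ^ 'd \<Rightarrow> real" where
  "lower_moment P v z = (LINT y|P. max 0 (v \<bullet> (z - y)))"

definition lower_quotient :: "(real ^ 'd) measure \<Rightarrow> real ^ 'd \<Rightarrow> real ^ 'd \<Rightarrow> real" where
  "lower_quotient P v z =
     lower_moment P v z / (2 * lower_moment P v z - v \<bullet> (z - mean_vec P))"

context
  fixes P :: "(real ^ 'd) measure"
  assumes P: "P \<in> prob_class"
begin

interpretation prob_space P
  using P by (simp add: prob_class_def)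

lemma sets_P [measurable_cong]: "sets P = sets borel"
  using P by (simp add: prob_class_def)

lemma integrable_id: "integrable P (\<lambda>y. y)"
  using P by (simp add: prob_class_def)

lemma integrable_shift: "integrable P (\<lambda>y. z - y)"
  using integrable_id by simp

lemma integrable_direction: "integrable P (\<lambda>y. v \<bullet> (z - y))"
  using integrable_shift by (rule integrable_inner_right)

lemma integrable_positive_part: "integrable P (\<lambda>y. max 0 (v \<bullet> (z - y)))"
  using integrable_direction by (intro integrable_max) simp_all

lemma integral_direction: "(LINT y|P. v \<bullet> (z - y)) = v \<bullet> (z - mean_vec P)"
  using integrable_id
  by (simp add: integral_inner_right[OF integrable_shift] mean_vec_def prob_space)

lemma lower_moment_nonneg: "0 \<le> lower_moment P v z"
  unfolding lower_moment_def by (rule integral_nonneg_AE) simp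

lemma integral_abs_direction:
  "(LINT y|P. \<bar>v \<bullet> (y - z)\<bar>) = 2 * lower_moment P v z - v \<bullet> (z - mean_vec P)"
proof -
  have "\<bar>v \<bullet> (y - z)\<bar> = 2 * max 0 (v \<bullet> (z - y)) - v \<bullet> (z - y)" for y
    by (simp add: inner_diff_right max_def)
  then show ?thesis
    using integrable_positive_part integrable_direction
    by (simp add: lower_moment_def integral_direction)
qed

lemma integral_lower_part:
  "(LINT y|P. \<bar>v \<bullet> (y - z)\<bar> * indicator {y. v \<bullet> (y - z) \<le> 0} y) = lower_moment P v z"
  unfolding lower_moment_def
  by (rule Bochner_Integration.integral_cong)
    (auto simp: inner_diff_right indicator_def max_def)

lemma expectile_depth_eq: "expectile_depth z P = (INF v\<in>sphere 0 1. lower_quotient P v z)"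
  by (simp add: expectile_depth_def lower_quotient_def integral_abs_direction integral_lower_part)

text \<open>A zero denominator would make \<open>v \<bullet> Z\<close> almost surely constant and thus put all mass on a
  hyperplane.\<close>

lemma denominator_pos:
  assumes "v \<noteq> 0"
  shows "0 < 2 * lower_moment P v z - v \<bullet> (z - mean_vec P)"
proof -
  have int: "integrable P (\<lambda>y. \<bar>v \<bullet> (y - z)\<bar>)"
    using integrable_abs[OF integrable_direction[of v z]]
    by (simp add: inner_diff_right abs_minus_commute)
  have "(LINT y|P. \<bar>v \<bullet> (y - z)\<bar>) \<noteq> 0"
  proof
    assume "(LINT y|P. \<bar>v \<bullet> (y - z)\<bar>) = 0"
    then have "AE y in P. v \<bullet> y = v \<bullet> z"
      using integral_nonneg_eq_0_iff_AE[OF int] by (simp add: inner_diff_right)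
    moreover have "{y. v \<bullet> y = v \<bullet> z} \<in> sets P"
      unfolding sets_P by (intro borel_closed closed_hyperplane)
    moreover have "space P = UNIV"
      using sets_eq_imp_space_eq[OF sets_P] by simp
    ultimately have "measure P {y. v \<bullet> y = v \<bullet> z} = 1"
      using prob_eq_1 by simp
    with P assms show False
      by (auto simp: prob_class_def)
  qed
  moreover have "0 \<le> (LINT y|P. \<bar>v \<bullet> (y - z)\<bar>)"
    by (rule integral_nonneg_AE) simp
  ultimately show ?thesis
    by (simp add: integral_abs_direction)
qed

lemma lower_quotient_nonneg: "v \<noteq> 0 \<Longrightarrow> 0 \<le> lower_quotient P v z"
  unfolding lower_quotient_def using denominator_pos[of v z] lower_moment_nonneg[of v z] by simp

lemma lower_quotient_pos_iff: "v \<noteq> 0 \<Longrightarrow> 0 < lower_quotient P v z \<longleftrightarrow> 0 < lower_moment P v z"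
  unfolding lower_quotient_def using denominator_pos[of v z] by (simp add: zero_less_divide_iff)

lemma lower_quotient_less_half_iff:
  "v \<noteq> 0 \<Longrightarrow> lower_quotient P v z < 1 / 2 \<longleftrightarrow> v \<bullet> (z - mean_vec P) < 0"
  unfolding lower_quotient_def using denominator_pos[of v z]
  by (simp add: pos_divide_less_eq)

lemma lower_quotient_mean: "v \<noteq> 0 \<Longrightarrow> lower_quotient P v (mean_vec P) = 1 / 2"
  unfolding lower_quotient_def using denominator_pos[of v "mean_vec P"] by simp


section \<open>Dependence on the direction and on the point\<close>

lemma lower_moment_mono:
  assumes "v \<bullet> z \<le> v \<bullet> z'"
  shows "lower_moment P v z \<le> lower_moment P v z'"
  unfolding lower_moment_def using assms
  by (intro integral_mono integrable_positive_part) (auto simp: inner_diff_right max_def)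

lemma lower_moment_lipschitz_point:
  "lower_moment P v z \<le> lower_moment P v z' + norm v * norm (z - z')"
proof -
  have "v \<bullet> z - v \<bullet> z' \<le> norm v * norm (z - z')"
    using norm_cauchy_schwarz[of v "z - z'"] by (simp add: inner_diff_right)
  moreover have "0 \<le> norm v * norm (z - z')"
    by simp
  ultimately have "max 0 (v \<bullet> (z - y)) \<le> max 0 (v \<bullet> (z' - y)) + norm v * norm (z - z')" for y
    unfolding inner_diff_right max_def by (simp split: if_splits)
  then have "lower_moment P v z \<le> (LINT y|P. max 0 (v \<bullet> (z' - y)) + norm v * norm (z - z'))"
    unfolding lower_moment_def
    by (intro integral_mono integrable_positive_part Bochner_Integration.integrable_add) simp_all
  also have "\<dots> = lower_moment P v z' + norm v * norm (z - z')"
    using integrable_positive_part by (simp add: lower_moment_def prob_space)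
  finally show ?thesis .
qed

lemma lower_moment_lipschitz_direction:
  "lower_moment P v z \<le> lower_moment P w z + norm (v - w) * (LINT y|P. norm (z - y))"
proof -
  have int: "integrable P (\<lambda>y. norm (z - y))"
    using integrable_shift by (rule integrable_norm)
  have "max 0 (v \<bullet> (z - y)) \<le> max 0 (w \<bullet> (z - y)) + norm (v - w) * norm (z - y)" for y
  proof -
    have "v \<bullet> (z - y) - w \<bullet> (z - y) \<le> norm (v - w) * norm (z - y)"
      using norm_cauchy_schwarz[of "v - w" "z - y"] by (simp add: inner_diff_left)
    moreover have "0 \<le> norm (v - w) * norm (z - y)"
      by simp
    ultimately show ?thesis
      unfolding max_def by (simp split: if_splits)
  qed
  then have "lower_moment P v z
      \<le> (LINT y|P. max 0 (w \<bullet> (z - y)) + norm (v - w) * norm (z - y))"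
    unfolding lower_moment_def using int
    by (intro integral_mono integrable_positive_part Bochner_Integration.integrable_add) simp_all
  also have "\<dots> = lower_moment P w z + norm (v - w) * (LINT y|P. norm (z - y))"
    using integrable_positive_part int by (simp add: lower_moment_def)
  finally show ?thesis .
qed

lemma continuous_lower_moment: "continuous_on S (\<lambda>v. lower_moment P v z)"
proof -
  define L where "L = (LINT y|P. norm (z - y))"
  have "0 \<le> L"
    unfolding L_def by (rule integral_nonneg_AE) simp
  moreover have "dist (lower_moment P v z) (lower_moment P w z) \<le> L * dist v w" for v w
    using lower_moment_lipschitz_direction[of v z w] lower_moment_lipschitz_direction[of w z v]
    by (simp add: L_def dist_norm abs_le_iff norm_minus_commute[of w v] mult.commute)
  ultimately show ?thesis
    by (intro lipschitz_on_continuous_on[of L] lipschitz_onI)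
qed

lemma continuous_lower_quotient: "continuous_on (sphere 0 1) (\<lambda>v. lower_quotient P v z)"
  unfolding lower_quotient_def
proof (intro continuous_intros continuous_lower_moment ballI)
  fix v :: "real ^ 'd"
  assume "v \<in> sphere 0 1"
  then have "v \<noteq> 0"
    by auto
  then show "2 * lower_moment P v z - v \<bullet> (z - mean_vec P) \<noteq> 0"
    using denominator_pos[of v z] by simp
qed

lemma expectile_depth_lower: "v \<in> sphere 0 1 \<Longrightarrow> expectile_depth z P \<le> lower_quotient P v z"
  unfolding expectile_depth_eq
  by (rule cINF_lower) (auto intro!: bdd_belowI2[of _ 0] lower_quotient_nonneg)

lemma expectile_depth_attained:
  obtains v where "v \<in> sphere 0 1" and "expectile_depth z P = lower_quotient P v z"
proof -
  have "(axis undefined 1 :: real ^ 'd) \<in> sphere 0 1"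
    by simp
  then have "sphere (0 :: real ^ 'd) 1 \<noteq> {}"
    by blast
  then obtain v where v: "v \<in> sphere 0 1"
    and min: "\<forall>w\<in>sphere 0 1. lower_quotient P v z \<le> lower_quotient P w z"
    using continuous_attains_inf[OF compact_sphere _ continuous_lower_quotient] by blast
  have "expectile_depth z P = lower_quotient P v z"
    unfolding expectile_depth_eq by (rule cInf_eq_minimum) (use v min in auto)
  with v show thesis
    by (rule that)
qed

lemma expectile_depth_nonneg: "0 \<le> expectile_depth z P"
proof -
  obtain v where "v \<in> sphere 0 1" "expectile_depth z P = lower_quotient P v z"
    by (rule expectile_depth_attained)
  then show ?thesis
    using lower_quotient_nonneg[of v z] by force
qed


section \<open>Depth and the \<open>C\<close>-support\<close>

lemma measure_halfspace_pos:
  assumes "0 < lower_moment P v z"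
  shows "0 < measure P {y. v \<bullet> y \<le> v \<bullet> z}"
proof (rule ccontr)
  have meas: "{y. v \<bullet> y \<le> v \<bullet> z} \<in> sets P"
    unfolding sets_P by (intro borel_closed closed_halfspace_le)
  assume "\<not> 0 < measure P {y. v \<bullet> y \<le> v \<bullet> z}"
  then have "measure P {y. v \<bullet> y \<le> v \<bullet> z} = 0"
    using measure_nonneg[of P "{y. v \<bullet> y \<le> v \<bullet> z}"] by linarith
  then have "AE y in P. y \<notin> {y. v \<bullet> y \<le> v \<bullet> z}"
    using meas by (simp add: prob_eq_0)
  then have "AE y in P. max 0 (v \<bullet> (z - y)) = 0"
    by eventually_elim (simp add: inner_diff_right)
  then have "lower_moment P v z = 0"
    unfolding lower_moment_def by (rule integral_eq_zero_AE)
  with assms show False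
    by simp
qed

lemma lower_moment_pos:
  assumes pos: "0 < measure P {y. v \<bullet> y \<le> c}" and less: "c < v \<bullet> z"
  shows "0 < lower_moment P v z"
proof (rule ccontr)
  assume "\<not> 0 < lower_moment P v z"
  then have "lower_moment P v z = 0"
    using lower_moment_nonneg[of v z] by linarith
  then have "AE y in P. max 0 (v \<bullet> (z - y)) = 0"
    unfolding lower_moment_def
    using integral_nonneg_eq_0_iff_AE[OF integrable_positive_part[of v z]] by simp
  then have "AE y in P. y \<notin> {y. v \<bullet> y \<le> c}"
    by eventually_elim (use less in \<open>auto simp: inner_diff_right max_def split: if_splits\<close>)
  moreover have "{y. v \<bullet> y \<le> c} \<in> sets P"
    unfolding sets_P by (intro borel_closed closed_halfspace_le)
  ultimately have "measure P {y. v \<bullet> y \<le> c} = 0"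
    using prob_eq_0 by blast
  with pos show False
    by simp
qed

text \<open>The step length is half of the minimum of the lower moment over the compact sphere: by the
  Lipschitz bound in the point, such a step leaves all lower moments positive.\<close>

lemma C_support_beyond_positive_depth:
  assumes u: "u \<in> sphere 0 1" and pos: "0 < expectile_depth z P"
  obtains e where "0 < e" and "z + e *\<^sub>R u \<in> C_support P"
proof -
  have moment_pos: "0 < lower_moment P v z" if "v \<in> sphere 0 1" for v
  proof -
    have "v \<noteq> 0"
      using that by auto
    then show ?thesis
      using lower_quotient_pos_iff[of v z] expectile_depth_lower[OF that, of z] pos by simp
  qed
  obtain w where w: "w \<in> sphere 0 1"
    and min: "\<And>v. v \<in> sphere 0 1 \<Longrightarrow> lower_moment P w z \<le> lower_moment P v z"
    using continuous_attains_inf[OF compact_sphere _ continuous_lower_moment] u by (metis empty_iff)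
  define e where "e = lower_moment P w z / 2"
  have e: "0 < e"
    using moment_pos[OF w] by (simp add: e_def)
  have "0 < lower_moment P v (z + e *\<^sub>R u)" if v: "v \<in> sphere 0 1" for v
    using lower_moment_lipschitz_point[of v z "z + e *\<^sub>R u"] min[OF v] u v e
    by (simp add: e_def)
  then have "z + e *\<^sub>R u \<in> C_support P"
    unfolding C_support_def using measure_halfspace_pos by blast
  with e show thesis
    by (rule that)
qed

lemma expectile_depth_eq_0_outside_C_support:
  assumes "z \<notin> C_support P"
  shows "expectile_depth z P = 0"
proof -
  obtain v where v: "v \<in> sphere 0 1" and null: "\<not> 0 < measure P {y. v \<bullet> y \<le> v \<bullet> z}"
    using assms by (auto simp: C_support_def)
  have "v \<noteq> 0"
    using v by auto
  moreover have "\<not> 0 < lower_moment P v z"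
    using null measure_halfspace_pos by blast
  ultimately have "\<not> 0 < lower_quotient P v z"
    by (simp add: lower_quotient_pos_iff)
  then show ?thesis
    using expectile_depth_lower[OF v, of z] expectile_depth_nonneg[of z] by linarith
qed


section \<open>Depth along a ray from the mean\<close>

lemma expectile_depth_mean: "expectile_depth (mean_vec P) P = 1 / 2"
proof -
  obtain v where "v \<in> sphere 0 1"
    and "expectile_depth (mean_vec P) P = lower_quotient P v (mean_vec P)"
    by (rule expectile_depth_attained)
  then show ?thesis
    using lower_quotient_mean[of v] by force
qed

lemma expectile_depth_less_half:
  assumes u: "u \<in> sphere 0 1" and r: "0 < r"
  shows "expectile_depth (mean_vec P + r *\<^sub>R u) P < 1 / 2"
proof -
  have "u \<noteq> 0"
    using u by auto
  then have "lower_quotient P (- u) (mean_vec P + r *\<^sub>R u) < 1 / 2"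
    using r by (subst lower_quotient_less_half_iff) simp_all
  moreover have "- u \<in> sphere 0 1"
    using u by simp
  ultimately show ?thesis
    using expectile_depth_lower[of "- u"] by (meson le_less_trans)
qed

text \<open>With \<open>N' \<le> N\<close> the lower moments and \<open>t < t'\<close> the distances behind the mean, the claim
  \<open>N' / (2 N' + t') < N / (2 N + t)\<close> reduces to \<open>N' t < N t'\<close>.\<close>

lemma lower_quotient_strict_decrease:
  assumes vu: "v \<bullet> u < 0" and r: "0 < r" "r < s"
    and pos: "0 < lower_moment P v (mean_vec P + r *\<^sub>R u)"
  shows "lower_quotient P v (mean_vec P + s *\<^sub>R u) < lower_quotient P v (mean_vec P + r *\<^sub>R u)"
proof -
  define N N' where "N = lower_moment P v (mean_vec P + r *\<^sub>R u)"
    and "N' = lower_moment P v (mean_vec P + s *\<^sub>R u)"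
  define t t' where "t = - (r * (v \<bullet> u))" and "t' = - (s * (v \<bullet> u))"
  have t: "0 < t" "t < t'"
    using vu r by (simp_all add: t_def t'_def mult_less_0_iff mult_pos_neg)
  have N: "0 < N" "0 \<le> N'"
    using pos lower_moment_nonneg by (simp_all add: N_def N'_def)
  have "s * (v \<bullet> u) \<le> r * (v \<bullet> u)"
    using t by (simp add: t_def t'_def)
  then have "N' \<le> N"
    unfolding N_def N'_def by (intro lower_moment_mono) (simp add: inner_add_right)
  then have "N' * t \<le> N * t"
    using t by simp
  also have "\<dots> < N * t'"
    using N t by simp
  finally have "N' * (2 * N + t) < N * (2 * N' + t')"
    by (simp add: algebra_simps)
  moreover have "0 < 2 * N + t" "0 < 2 * N' + t'"
    using N t by simp_all
  ultimately have "N' / (2 * N' + t') < N / (2 * N + t)"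
    by (simp add: frac_less_eq divide_less_eq less_divide_eq mult.commute)
  then show ?thesis
    by (simp add: lower_quotient_def N_def N'_def t_def t'_def)
qed

lemma expectile_depth_strict_decrease:
  assumes u: "u \<in> sphere 0 1" and r: "0 \<le> r" "r < s" and radius: "ereal r < C_radius u P"
  shows "expectile_depth (mean_vec P + s *\<^sub>R u) P < expectile_depth (mean_vec P + r *\<^sub>R u) P"
proof (cases "r = 0")
  case True
  then show ?thesis
    using expectile_depth_less_half[OF u, of s] r by (simp add: expectile_depth_mean)
next
  case False
  with r have r0: "0 < r"
    by simp
  obtain v where v: "v \<in> sphere 0 1"
    and depth: "expectile_depth (mean_vec P + r *\<^sub>R u) P = lower_quotient P v (mean_vec P + r *\<^sub>R u)"
    by (rule expectile_depth_attained)
  have "v \<noteq> 0"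
    using v by auto
  moreover have "lower_quotient P v (mean_vec P + r *\<^sub>R u) < 1 / 2"
    using expectile_depth_less_half[OF u r0] depth by simp
  ultimately have vu: "v \<bullet> u < 0"
    using r0 by (subst (asm) lower_quotient_less_half_iff) (simp_all add: mult_less_0_iff)
  obtain q where q: "r < q" "mean_vec P + q *\<^sub>R u \<in> C_support P"
    using radius by (auto simp: C_radius_def less_Sup_iff)
  have "0 < measure P {y. v \<bullet> y \<le> v \<bullet> (mean_vec P + q *\<^sub>R u)}"
    using q v by (simp add: C_support_def)
  moreover have "v \<bullet> (mean_vec P + q *\<^sub>R u) < v \<bullet> (mean_vec P + r *\<^sub>R u)"
    using q vu by (simp add: inner_add_right)
  ultimately have "0 < lower_moment P v (mean_vec P + r *\<^sub>R u)"
    by (rule lower_moment_pos)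
  then have "lower_quotient P v (mean_vec P + s *\<^sub>R u) < lower_quotient P v (mean_vec P + r *\<^sub>R u)"
    using vu r0 r by (intro lower_quotient_strict_decrease)
  then show ?thesis
    using expectile_depth_lower[OF v] depth by (metis le_less_trans)
qed

lemma C_radius_upper:
  "0 < r \<Longrightarrow> mean_vec P + r *\<^sub>R u \<in> C_support P \<Longrightarrow> ereal r \<le> C_radius u P"
  unfolding C_radius_def by (rule Sup_upper) simp

lemma C_radius_pos:
  assumes "u \<in> sphere 0 1"
  shows "0 < C_radius u P"
proof -
  obtain e where e: "0 < e" "mean_vec P + e *\<^sub>R u \<in> C_support P"
    using C_support_beyond_positive_depth[OF assms, of "mean_vec P"]
    by (auto simp: expectile_depth_mean)
  then have "ereal e \<le> C_radius u P"
    by (rule C_radius_upper)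
  with e(1) show ?thesis
    by (metis ereal_less(2) less_le_trans)
qed

lemma expectile_depth_eq_0_beyond_radius:
  assumes u: "u \<in> sphere 0 1" and r: "C_radius u P \<le> ereal r"
  shows "expectile_depth (mean_vec P + r *\<^sub>R u) P = 0"
proof (rule ccontr)
  assume "expectile_depth (mean_vec P + r *\<^sub>R u) P \<noteq> 0"
  then have "0 < expectile_depth (mean_vec P + r *\<^sub>R u) P"
    using expectile_depth_nonneg[of "mean_vec P + r *\<^sub>R u"] by linarith
  then obtain e where e: "0 < e" "mean_vec P + r *\<^sub>R u + e *\<^sub>R u \<in> C_support P"
    by (rule C_support_beyond_positive_depth[OF u])
  have "0 < r"
    using C_radius_pos[OF u] r by (metis ereal_less(2) less_le_trans)
  then have "ereal (r + e) \<le> C_radius u P"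
    using e by (intro C_radius_upper) (simp_all add: scaleR_add_left add.assoc)
  then have "ereal (r + e) \<le> ereal r"
    using r by (rule order_trans)
  with e(1) show False
    by simp
qed

end

theorem theorem5p2:
  fixes P :: "(real ^ 'd) measure" and u :: "real ^ 'd"
  assumes "P \<in> prob_class" and "u \<in> sphere 0 1"
  shows "0 < C_radius u P
    \<and> strict_antimono_on {r. 0 \<le> r \<and> ereal r \<le> C_radius u P}
        (\<lambda>r. expectile_depth (mean_vec P + r *\<^sub>R u) P)
    \<and> (\<forall>r. C_radius u P \<le> ereal r \<longrightarrow> expectile_depth (mean_vec P + r *\<^sub>R u) P = 0)"
proof (intro conjI allI impI)
  show "0 < C_radius u P"
    using assms by (rule C_radius_pos)
  show "strict_antimono_on {r. 0 \<le> r \<and> ereal r \<le> C_radius u P}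
      (\<lambda>r. expectile_depth (mean_vec P + r *\<^sub>R u) P)"
  proof (rule monotone_onI)
    fix r s :: real
    assume "r \<in> {r. 0 \<le> r \<and> ereal r \<le> C_radius u P}" "s \<in> {r. 0 \<le> r \<and> ereal r \<le> C_radius u P}"
      and rs: "r < s"
    then have "0 \<le> r" and "ereal s \<le> C_radius u P"
      by simp_all
    moreover from this have "ereal r < C_radius u P"
      using rs by (metis ereal_less_eq(3) less_le_trans linorder_not_le)
    ultimately show "expectile_depth (mean_vec P + r *\<^sub>R u) P
        > expectile_depth (mean_vec P + s *\<^sub>R u) P"
      using assms rs by (intro expectile_depth_strict_decrease) simp_all
  qed
  show "expectile_depth (mean_vec P + r *\<^sub>R u) P = 0" if "C_radius u P \<le> ereal r" for r
    using assms that by (rule expectile_depth_eq_0_beyond_radius)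
qed

end
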